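(* Let $d\geq 1$ and let $(F_n)$ be a Følner sequence of $\mathbb{Z}^d$. Assume that $\mu_{F_n,\mathsf{cop}}$ converges weakly to some probability measure $\mu$ on $\Omega_{\{0,1\}}$. Then $\mu$ is stochastically dominated by $\mu_{\infty,\mathsf{cop}}$.
   Context: A sequence $(F_n)$ of finite nonempty subsets of $\mathbb{Z}^d$ is a Følner sequence if for every $y\in\mathbb{Z}^d$, $|F_n\Delta(F_n+y)|=o(|F_n|)$. $\Omega_{\{0,1\}}:=\{0,1\}^{\mathbb{Z}^d}$ with the product topology; probability measures on it carry the weak topology; elements are identified with subsets of $\mathbb{Z}^d$ via indicator functions. For probability measures $\mu,\nu$ on $\Omega_{\{0,1\}}$, $\mu$ is stochastically dominated by $\nu$ if there is a coupling $(\mathcal{W},\mathcal{W}')$ of $(\mu,\nu)$ such that $\mathcal{W}\subset\mathcal{W}'$ almost surely. $\mathsf{cop}\in\Omega_{\{0,1\}}$ is defined by $\mathsf{cop}(x)=1$ if $\gcd(x_1,\dots,x_d)=1$ and $\mathsf{cop}(x)=0$ otherwise. For a nonempty finite $F\subset\mathbb{Z}^d$, $\mu_{F,\mathsf{cop}}$ is the distribution of the random element $x\mapsto \mathsf{cop}(x+Y)$, where $Y$ is uniformly distributed in $F$. Definition of $\mu_{\infty,\mathsf{cop}}$: independently for every prime $p$, let $\mathcal{W}_p$ be a uniformly chosen coset of $p\mathbb{Z}^d$ in $\mathbb{Z}^d$ (among the $p^d$ cosets). Then $\mu_{\infty,\mathsf{cop}}$ is the distribution of the indicator function of $\mathbb{Z}^d\setminus\bigcup_p\mathcal{W}_p$,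 i.e. of $x\mapsto\min_p \mathbf{1}_{x\notin\mathcal{W}_p}$. *)

theory Defs
  imports "HOL-Probability.Probability"
begin

text \<open>
  The lattice is \<^typ>\<open>int ^ 'd\<close>, and the configuration space is \<^typ>\<open>int ^ 'd \<Rightarrow> bool\<close>, with
  \<^const>\<open>False\<close> and \<^const>\<open>True\<close> playing the roles of 0 and 1.  As \<^typ>\<open>bool\<close> carries the discrete
  topology and functions carry the product topology, \<^term>\<open>borel :: (int ^ 'd \<Rightarrow> bool) measure\<close>
  is the Borel sigma-algebra of the product topology.
\<close>

text \<open>
  With this instance the library identifies the Borel sets of a countable power of \<^typ>\<open>bool\<close>
  with the product sigma-algebra.
\<close>

instance bool :: second_countable_topology
proof
  have "open = generate_topology (range (\<lambda>b. {b::bool}))"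
  proof (intro ext iffI)
    fix S :: "bool set"
    have "generate_topology (range (\<lambda>b. {b::bool})) (\<Union> ((\<lambda>b. {b}) ` S))"
      by (rule generate_topology.UN) (auto intro: generate_topology.Basis)
    then show "generate_topology (range (\<lambda>b. {b::bool})) S"
      by simp
  qed (rule discrete_topology_class.open_discrete)
  then show "\<exists>B::bool set set. countable B \<and> open = generate_topology B"
    by (intro exI[of _ "range (\<lambda>b. {b::bool})"]) simp
qed

type_synonym 'd config = "int ^ 'd \<Rightarrow> bool"

definition folner :: "(nat \<Rightarrow> (int ^ 'd::finite) set) \<Rightarrow> bool" where
  "folner F \<longleftrightarrow>
     (\<forall>n. finite (F n) \<and> F n \<noteq> {}) \<and>
     (\<forall>y. (\<lambda>n. real (card (sym_diff (F n) ((\<lambda>x. x + y) ` F n)))) \<in> o(\<lambda>n. real (card (F n))))"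

text \<open>The library's weak convergence is restricted to measures on the real line.\<close>

definition converges_weakly :: "(nat \<Rightarrow> 'a::topological_space measure) \<Rightarrow> 'a measure \<Rightarrow> bool" where
  "converges_weakly M N \<longleftrightarrow>
     (\<forall>f::'a \<Rightarrow> real. continuous_on UNIV f \<and> bounded (range f) \<longrightarrow>
        (\<lambda>n. integral\<^sup>L (M n) f) \<longlonglongrightarrow> integral\<^sup>L N f)"

text \<open>A coupling is represented by its joint law on the product space.\<close>

definition coupling ::
    "('d::finite config \<times> 'd config) measure \<Rightarrow> 'd config measure \<Rightarrow> 'd config measure \<Rightarrow> bool" where
  "coupling K \<mu> \<nu> \<longleftrightarrow>
     prob_space K \<and> sets K = sets (borel \<Otimes>\<^sub>M borel) \<and>
     distr K borel fst = \<mu> \<and> distr K borel snd = \<nu>"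

definition stoch_dominated :: "'d::finite config measure \<Rightarrow> 'd config measure \<Rightarrow> bool" where
  "stoch_dominated \<mu> \<nu> \<longleftrightarrow>
     (\<exists>K. coupling K \<mu> \<nu> \<and> (AE w in K. {x. fst w x} \<subseteq> {x. snd w x}))"

definition cop :: "'d::finite config" where
  "cop x \<longleftrightarrow> Gcd (range (\<lambda>i. x $ i)) = 1"

definition mu_cop :: "(int ^ 'd) set \<Rightarrow> 'd::finite config measure" where
  "mu_cop F = distr (uniform_count_measure F) borel (\<lambda>y x. cop (x + y))"

definition cosets :: "nat \<Rightarrow> (int ^ 'd::finite) set set" where
  "cosets p = range (\<lambda>a. range (\<lambda>z. a + int p *s z))"

definition mu_inf_cop :: "'d::finite config measure" where
  "mu_inf_cop =
     distr (\<Pi>\<^sub>M p\<in>{p. prime p}. uniform_count_measure (cosets p)) borel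
       (\<lambda>W x. x \<notin> (\<Union>p\<in>{p. prime p}. W p))"

end

theory Submission
  imports Defs
begin

text \<open>
  A point \<open>x\<close> is coprime exactly when no prime divides all its coordinates.  For \<open>Y\<close> uniform in \<open>F n\<close>,
  the set of \<open>x\<close> with \<open>x + Y\<close> coprime therefore avoids, for every prime \<open>p\<close>, the coset
  \<open>-Y + p\<int>\<^sup>d\<close>.  Because of the Folner property these cosets become asymptotically uniform and
  independent over any finite set of primes (\<open>coset_equidistribution\<close>): translating by
  multiples of the product of the other primes moves \<open>Y\<close> through all classes modulo \<open>p\<close> and leaves
  its classes modulo the others unchanged.

  The pair formed by the coprime set and the residues is a random element of a Cantor space.  Probability
  measures on that space are weakly sequentially compact (\<open>weakly_convergent_subsequence\<close>), so
  the joint laws have a limit point \<open>L\<close>.  Its first marginal is \<open>\<mu>\<close>, and its second marginal is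
  the law of the independent uniform cosets, since both are determined by cylinder probabilities.
  Under \<open>L\<close> the first configuration still avoids every single coset almost surely, each instance being
  a clopen condition.  There are countably many instances, so it is almost surely contained in the
  complement of the union of all cosets, and this gives the coupling.

  Before the limit the coprime set equals the complement of the union.  The equality can be lost, since
  which points survive all primes is not a continuous function of the residues, but the inclusion
  cannot.  For the same reason the residues themselves are carried through the limit and the infinite
  intersection is formed only afterwards.
\<close>

section \<open>Weak compactness on Cantor spaces\<close>

lemma compact_UNIV_bool_configs: "compact (UNIV :: ('i \<Rightarrow> bool) set)"
proof -
  have "compact_space (euclidean :: bool topology)"
    by (simp add: compact_space_def finite_imp_compact)
  then have "compact_space (product_topology (\<lambda>_. euclidean :: bool topology) (UNIV :: 'i set))"
    by (simp add: compact_space_product_topology)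
  then show ?thesis
    by (simp add: euclidean_product_topology compact_space_def)
qed

lemma continuous_on_of_bool:
  fixes Q :: "'a::topological_space \<Rightarrow> bool"
  assumes "continuous_on UNIV Q"
  shows "continuous_on UNIV (\<lambda>x. of_bool (Q x) :: real)"
  by (rule continuous_on_compose2[OF Topological_Spaces.continuous_on_discrete assms, of UNIV]) auto

text \<open>
  Distinct bit sequences get distinct values because the base is larger than 2: a digit 1 at
  position \<open>n\<close> outweighs all later digits together.  In base 2 the expansions would not be unique.
\<close>

definition base4 :: "('i::countable \<Rightarrow> bool) \<Rightarrow> real" where
  "base4 w = (\<Sum>n. of_bool (w (from_nat n)) * (1/4) ^ n)"

lemma summable_base4: "summable (\<lambda>n. of_bool (b n) * (1/4) ^ n :: real)"
  by (rule summable_comparison_test[OF _ summable_geometric[of "1/4 :: real"]])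
     (auto intro!: exI[of _ 0])

lemma continuous_on_base4: "continuous_on UNIV base4"
proof -
  have "uniform_limit UNIV (\<lambda>n (w :: 'i::countable \<Rightarrow> bool). \<Sum>k<n. of_bool (w (from_nat k)) * (1/4) ^ k)
      (\<lambda>w. \<Sum>k. of_bool (w (from_nat k)) * (1/4 :: real) ^ k) sequentially"
    by (rule Weierstrass_m_test[where M = "\<lambda>n. (1/4) ^ n"]) (auto intro: summable_geometric)
  then show ?thesis
    unfolding base4_def[abs_def]
    by (rule uniform_limit_theorem[rotated])
       (auto intro!: always_eventually continuous_on_sum continuous_on_mult continuous_on_of_bool
          simp del: sum_of_bool_mult_eq sum_mult_of_bool_eq)
qed

lemma base4_less:
  assumes "\<forall>k<n. u (from_nat k) = v (from_nat k)" "\<not> u (from_nat n)" "v (from_nat n)"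
  shows "base4 u < base4 v"
proof -
  define d where "d k = (of_bool (v (from_nat k)) - of_bool (u (from_nat k))) * (1/4 :: real) ^ k" for k
  have d: "summable d"
    unfolding d_def left_diff_distrib by (intro summable_diff summable_base4)
  have geo: "(\<lambda>k. (1/4) ^ (k + Suc n)) sums ((1/4) ^ n / 3 :: real)"
    using sums_mult2[OF geometric_sums[of "1/4 :: real"], of "(1/4) ^ Suc n"]
    by (simp add: power_add field_simps)
  have "- ((1/4) ^ n / 3) \<le> (\<Sum>k. d (k + Suc n))"
  proof (rule sums_le[OF _ sums_minus[OF geo]])
    show "- ((1/4) ^ (k + Suc n)) \<le> d (k + Suc n)" for k
      by (simp add: d_def)
    show "(\<lambda>k. d (k + Suc n)) sums (\<Sum>k. d (k + Suc n))"
      using d by (intro summable_sums) (simp only: summable_iff_shift)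
  qed
  moreover have "sum d {..<Suc n} = (1/4) ^ n"
    using assms by (simp add: d_def)
  moreover have "0 < (1/4 :: real) ^ n" by simp
  ultimately have "0 < suminf d"
    using suminf_split_initial_segment[OF d, of "Suc n"] by linarith
  moreover have "suminf d = base4 v - base4 u"
    unfolding d_def left_diff_distrib base4_def
    by (rule suminf_diff[symmetric]) (rule summable_base4)+
  ultimately show ?thesis by simp
qed

lemma inj_base4: "inj base4"
proof (rule injI, rule ccontr)
  fix u v :: "'i::countable \<Rightarrow> bool"
  assume eq: "base4 u = base4 v" and "u \<noteq> v"
  then obtain i where "u i \<noteq> v i" by auto
  then have ex: "\<exists>n. u (from_nat n) \<noteq> v (from_nat n)"
    by (intro exI[of _ "to_nat i"]) simp
  define n where "n = (LEAST n. u (from_nat n) \<noteq> v (from_nat n))"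
  have "u (from_nat n) \<noteq> v (from_nat n)" "\<forall>k<n. u (from_nat k) = v (from_nat k)"
    using LeastI_ex[OF ex] not_less_Least[of _ "\<lambda>n. u (from_nat n) \<noteq> v (from_nat n)"]
    unfolding n_def by blast+
  then show False
    using base4_less[of n u v] base4_less[of n v u] eq by auto
qed

text \<open>
  The distance to \<open>C\<close>, truncated at 1, is a bounded continuous test function with mean 0 under every
  \<open>M n\<close>, hence under \<open>L\<close>; as \<open>C\<close> is closed, distance 0 means membership.
\<close>

lemma weak_limit_closed_support:
  fixes M :: "nat \<Rightarrow> real measure"
  assumes M: "\<And>n. real_distribution (M n)" and L: "real_distribution L" and w: "weak_conv_m M L"
    and C: "closed C" "C \<noteq> {}" and supp: "\<And>n. AE x in M n. x \<in> C"
  shows "AE x in L. x \<in> C"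
proof -
  interpret L: real_distribution L by fact
  define g where "g x = min 1 (infdist x C)" for x
  have cont: "continuous_on UNIV g"
    unfolding g_def by (intro continuous_intros)
  have bound: "norm (g x) \<le> 1" for x
    unfolding g_def using infdist_nonneg[of x C] by auto
  have g0: "g x = 0 \<longleftrightarrow> x \<in> C" for x
    using C infdist_nonneg[of x C] by (auto simp: g_def in_closed_iff_infdist_zero min_def)
  have [measurable]: "g \<in> borel_measurable borel"
    using cont by (rule borel_measurable_continuous_onI)
  have "(\<lambda>n. integral\<^sup>L (M n) g) \<longlonglongrightarrow> integral\<^sup>L L g"
    by (rule weak_conv_imp_integral_bdd_continuous_conv[OF M L w])
       (use cont bound in \<open>auto simp: continuous_on_eq_continuous_at\<close>)
  moreover have "integral\<^sup>L (M n) g = 0" for n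
    by (rule integral_eq_zero_AE) (use supp[of n] g0 in auto)
  ultimately have "integral\<^sup>L L g = 0"
    by (simp add: LIMSEQ_const_iff)
  moreover have "integrable L g"
    by (rule L.integrable_const_bound[of _ 1]) (use bound in auto)
  ultimately have "AE x in L. g x = 0"
    by (subst integral_nonneg_eq_0_iff_AE[symmetric]) (auto simp: g_def infdist_nonneg)
  then show ?thesis by (simp add: g0)
qed

text \<open>
  Sequential compactness of the probability measures on \<open>{0,1}\<^sup>I\<close> for countable \<open>I\<close>.  The Cantor
  space is compact, so \<^const>\<open>base4\<close> embeds it homeomorphically as a compact subset \<open>C\<close> of the real
  line.  The images of the measures are tight, Helly's selection theorem gives a limit law on the
  line, that law is carried by \<open>C\<close>, and decoding brings it back.  Bounded continuous functions on
  \<open>C\<close> extend to the line by Tietze's theorem, which transports weak convergence.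
\<close>

lemma weakly_convergent_subsequence:
  fixes M :: "nat \<Rightarrow> ('i::countable \<Rightarrow> bool) measure"
  assumes prob: "\<And>n. prob_space (M n)" and sets: "\<And>n. sets (M n) = sets borel"
  obtains r K where "strict_mono (r :: nat \<Rightarrow> nat)" "prob_space K" "sets K = sets borel"
    "converges_weakly (M \<circ> r) K"
proof -
  define C where "C = range (base4 :: ('i \<Rightarrow> bool) \<Rightarrow> real)"
  define R where "R n = distr (M n) borel base4" for n
  define decode where "decode x = (if x \<in> C then inv base4 x else (\<lambda>_::'i. False))" for x
  have [simp]: "decode (base4 w) = w" for w
    by (simp add: decode_def C_def inv_f_f[OF inj_base4])
  have base4_meas: "base4 \<in> borel_measurable (M n)" for n
    using borel_measurable_continuous_onI[OF continuous_on_base4] measurable_cong_sets[OF sets refl]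
    by blast
  have R: "real_distribution (R n)" for n
    unfolding R_def using prob base4_meas by (rule prob_space.real_distribution_distr)
  have compact: "compact C"
    unfolding C_def by (rule compact_continuous_image[OF continuous_on_base4 compact_UNIV_bool_configs])
  then have C: "closed C" "C \<noteq> {}"
    by (auto simp: compact_imp_closed C_def)
  have cont_decode: "continuous_on C decode"
    unfolding C_def
    by (rule continuous_on_inv[OF continuous_on_base4 compact_UNIV_bool_configs]) simp
  have decode_meas [measurable]: "decode \<in> borel_measurable borel"
  proof -
    have "(\<lambda>x. if x \<in> C then decode x else (\<lambda>_::'i. False)) \<in> borel_measurable borel"
      using C by (intro borel_measurable_continuous_on_if cont_decode) auto
    also have "(\<lambda>x. if x \<in> C then decode x else (\<lambda>_::'i. False)) = decode"
      by (auto simp: decode_def)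
    finally show ?thesis .
  qed
  have "tight R"
  proof -
    have "bounded C" using compact by (rule compact_imp_bounded)
    then obtain B where B: "\<And>x. x \<in> C \<Longrightarrow> \<bar>x\<bar> \<le> B"
      by (auto simp: bounded_iff)
    have "0 \<le> B" using B C(2) by fastforce
    have "measure (R n) {-B-1<..B} = 1" for n
    proof -
      interpret prob_space "M n" by (rule prob)
      have "base4 w \<in> {-B-1<..B}" for w :: "'i \<Rightarrow> bool"
        using B[of "base4 w"] by (auto simp: C_def abs_le_iff)
      then have "base4 -` {-B-1<..B} \<inter> space (M n) = space (M n)"
        by blast
      then show ?thesis
        unfolding R_def using base4_meas by (simp add: measure_distr prob_space)
    qed
    then show ?thesis
      unfolding tight_def using R \<open>0 \<le> B\<close>
      by (intro conjI allI impI exI[of _ "-B-1"] exI[of _ B]) auto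
  qed
  then obtain r L where r: "strict_mono (r :: nat \<Rightarrow> nat)" and L: "real_distribution L"
    and conv: "weak_conv_m (R \<circ> r) L"
    using tight_imp_convergent_subsubsequence[of R id] by (auto simp: strict_mono_id)
  interpret L: real_distribution L by fact
  have LC: "AE x in L. x \<in> C"
  proof (rule weak_limit_closed_support[OF _ L conv C])
    show "AE x in (R \<circ> r) n. x \<in> C" for n
      unfolding R_def comp_def using C base4_meas
      by (subst AE_distr_iff) (auto simp: C_def)
  qed (simp add: R)
  have "converges_weakly (M \<circ> r) (distr L borel decode)"
    unfolding converges_weakly_def
  proof safe
    fix f :: "('i \<Rightarrow> bool) \<Rightarrow> real"
    assume f: "continuous_on UNIV f" and "bounded (range f)"
    then obtain B where B: "\<And>w. norm (f w) \<le> B" by (auto simp: bounded_iff)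
    then have "0 \<le> B" using norm_ge_zero order_trans by blast
    have [measurable]: "f \<in> borel_measurable borel"
      using f by (rule borel_measurable_continuous_onI)
    \<comment> \<open>\<open>f \<circ> decode\<close> itself may jump at points of \<open>C\<close>; only its restriction to \<open>C\<close> is continuous.\<close>
    obtain g where g: "continuous_on UNIV g" "\<And>x. x \<in> C \<Longrightarrow> g x = f (decode x)"
      "\<And>x. norm (g x) \<le> B"
    proof (rule Tietze[of C "\<lambda>x. f (decode x)" UNIV B])
      show "continuous_on C (\<lambda>x. f (decode x))"
        by (rule continuous_on_compose2[OF f cont_decode]) auto
    qed (use C B \<open>0 \<le> B\<close> in auto)
    have [measurable]: "g \<in> borel_measurable borel"
      using g(1) by (rule borel_measurable_continuous_onI)
    have "(\<lambda>n. integral\<^sup>L ((R \<circ> r) n) g) \<longlonglongrightarrow> integral\<^sup>L L g"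
      by (rule weak_conv_imp_integral_bdd_continuous_conv[OF _ L conv])
         (use g R in \<open>auto simp: continuous_on_eq_continuous_at\<close>)
    moreover have "integral\<^sup>L ((R \<circ> r) n) g = integral\<^sup>L ((M \<circ> r) n) f" for n
      unfolding R_def comp_def using base4_meas g(2) by (subst integral_distr) (auto simp: C_def)
    moreover have "integral\<^sup>L L g = integral\<^sup>L (distr L borel decode) f"
    proof -
      have "integral\<^sup>L L g = integral\<^sup>L L (\<lambda>x. f (decode x))"
        by (rule integral_cong_AE) (use LC g(2) in auto)
      then show ?thesis by (subst integral_distr) auto
    qed
    ultimately show "(\<lambda>n. integral\<^sup>L ((M \<circ> r) n) f) \<longlonglongrightarrow> integral\<^sup>L (distr L borel decode) f"
      by simp
  qed
  then show thesis
    using that[of r "distr L borel decode"] r L.prob_space_distr[of decode borel] by simp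
qed

section \<open>Weak limits and cylinder sets\<close>

lemma converges_weakly_subsequence:
  assumes "converges_weakly M N" "strict_mono r"
  shows "converges_weakly (M \<circ> r) N"
  using assms LIMSEQ_subseq_LIMSEQ unfolding converges_weakly_def comp_def by blast

lemma converges_weakly_distr:
  fixes h :: "'a::topological_space \<Rightarrow> 'b::topological_space"
  assumes "converges_weakly M N" and h: "continuous_on UNIV h"
    and sets: "\<And>n. sets (M n) = sets borel" "sets N = sets borel"
  shows "converges_weakly (\<lambda>n. distr (M n) borel h) (distr N borel h)"
  unfolding converges_weakly_def
proof safe
  have h': "h \<in> borel_measurable (M n)" "h \<in> borel_measurable N" for n
    using borel_measurable_continuous_onI[OF h] sets measurable_cong_sets by blast+
  fix f :: "'b \<Rightarrow> real" assume f: "continuous_on UNIV f" and b: "bounded (range f)"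
  have [measurable]: "f \<in> borel_measurable borel"
    using f by (rule borel_measurable_continuous_onI)
  have "(\<lambda>n. integral\<^sup>L (M n) (\<lambda>x. f (h x))) \<longlonglongrightarrow> integral\<^sup>L N (\<lambda>x. f (h x))"
    using assms(1) continuous_on_compose2[OF f h] bounded_subset[OF b, of "range (\<lambda>x. f (h x))"]
    unfolding converges_weakly_def by blast
  then show "(\<lambda>n. integral\<^sup>L (distr (M n) borel h) f) \<longlonglongrightarrow> integral\<^sup>L (distr N borel h) f"
    using h' by (simp add: integral_distr)
qed

lemma of_bool_Ball_eq_prod:
  "finite P \<Longrightarrow> of_bool (\<forall>p\<in>P. Q p) = (\<Prod>p\<in>P. of_bool (Q p) :: 'a::comm_semiring_1)"
  by (induction rule: finite_induct) (simp_all add: of_bool_conj)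

text \<open>
  Cylinders are clopen, so their indicator functions are continuous test functions; there is no
  boundary to control.
\<close>

lemma converges_weakly_cylinder:
  fixes M :: "nat \<Rightarrow> ('i::countable \<Rightarrow> bool) measure"
  assumes "converges_weakly M N" and J: "finite J"
    and sets: "\<And>n. sets (M n) = sets borel" "sets N = sets borel"
  shows "(\<lambda>n. measure (M n) {w. \<forall>i\<in>J. w i \<in> A i}) \<longlonglongrightarrow> measure N {w. \<forall>i\<in>J. w i \<in> A i}"
proof -
  let ?S = "{w. \<forall>i\<in>J. w i \<in> A i}"
  have prod: "indicator ?S w = (\<Prod>i\<in>J. of_bool (w i \<in> A i) :: real)" for w
    using of_bool_Ball_eq_prod[OF J, of "\<lambda>i. w i \<in> A i"] by (simp add: indicator_def)
  have "continuous_on UNIV (indicator ?S :: _ \<Rightarrow> real)"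
    unfolding prod[abs_def]
    by (intro continuous_on_prod continuous_on_compose2[OF
          Topological_Spaces.continuous_on_discrete[of UNIV "\<lambda>b. of_bool (b \<in> A i) :: real" for i]
          continuous_on_product_coordinates]) auto
  moreover have "bounded (range (indicator ?S :: _ \<Rightarrow> real))"
    by (rule bounded_subset[of "{0, 1}"]) (auto simp: indicator_def)
  ultimately have "(\<lambda>n. integral\<^sup>L (M n) (indicator ?S)) \<longlonglongrightarrow> (integral\<^sup>L N (indicator ?S) :: real)"
    using assms(1) unfolding converges_weakly_def by blast
  moreover have "space (M n) = UNIV" "space N = UNIV" for n
    using sets_eq_imp_space_eq[OF sets(1), of n] sets_eq_imp_space_eq[OF sets(2)] by simp_all
  ultimately show ?thesis by simp
qed

lemma config_measure_eqI:
  fixes P Q :: "('i::countable \<Rightarrow> bool) measure"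
  assumes "finite_measure P" "finite_measure Q"
    and sets: "sets P = sets borel" "sets Q = sets borel"
    and eq: "\<And>J A. finite J \<Longrightarrow>
      measure P {w. \<forall>i\<in>J. w i \<in> A i} = measure Q {w. \<forall>i\<in>J. w i \<in> A i}"
  shows "P = Q"
proof (rule measure_eqI_PiM_infinite[where I = UNIV and M = "\<lambda>_. borel"])
  show "sets P = sets (\<Pi>\<^sub>M i\<in>UNIV. borel)" "sets Q = sets (\<Pi>\<^sub>M i\<in>UNIV. borel)"
    by (simp_all only: sets sets_PiM_equal_borel)
  fix A :: "'i \<Rightarrow> bool set" and J :: "'i set" assume "finite J"
  have "prod_emb UNIV (\<lambda>_. borel) J (Pi\<^sub>E J A) = {w. \<forall>i\<in>J. w i \<in> A i}"
    by (auto simp: prod_emb_def PiE_iff)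
  then show "emeasure P (prod_emb UNIV (\<lambda>_. borel) J (Pi\<^sub>E J A)) =
      emeasure Q (prod_emb UNIV (\<lambda>_. borel) J (Pi\<^sub>E J A))"
    using eq[OF \<open>finite J\<close>, of A] assms(1,2) by (simp add: finite_measure.emeasure_eq_measure)
qed (rule assms)

section \<open>Folner averages and cosets\<close>

text \<open>
  The two sums differ only on the symmetric difference of \<open>F n\<close> and its translate, which a Folner
  sequence makes negligible against \<open>card (F n)\<close>.
\<close>

lemma folner_shift_invariant:
  fixes f :: "int ^ 'd::finite \<Rightarrow> real"
  assumes F: "folner F" and B: "\<And>x. \<bar>f x\<bar> \<le> B"
  shows "(\<lambda>n. (\<Sum>x\<in>F n. f (x + y)) / card (F n) - (\<Sum>x\<in>F n. f x) / card (F n)) \<longlonglongrightarrow> 0"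
proof -
  let ?S = "\<lambda>n. (\<lambda>x. x + y) ` F n"
  have fin: "finite (F n)" for n
    using F by (simp add: folner_def)
  have "(\<lambda>n. real (card (sym_diff (F n) (?S n)))) \<in> o(\<lambda>n. real (card (F n)))"
    using F by (simp add: folner_def)
  then have lim: "(\<lambda>n. B * (real (card (sym_diff (F n) (?S n))) / real (card (F n)))) \<longlonglongrightarrow> 0"
    by (intro tendsto_mult_right_zero smalloD_tendsto)
  have bound: "\<bar>(\<Sum>x\<in>F n. f (x + y)) - (\<Sum>x\<in>F n. f x)\<bar> \<le> B * card (sym_diff (F n) (?S n))" for n
  proof -
    have "(\<Sum>x\<in>F n. f (x + y)) = sum f (?S n)"
      by (subst sum.reindex) (auto simp: inj_on_def)
    moreover have "sum f (?S n) = sum f (?S n - F n) + sum f (?S n \<inter> F n)"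
      "sum f (F n) = sum f (F n - ?S n) + sum f (?S n \<inter> F n)"
      using sum.Int_Diff[of "?S n" f "F n"] sum.Int_Diff[of "F n" f "?S n"] fin
      by (simp_all add: Int_commute)
    ultimately have diff: "(\<Sum>x\<in>F n. f (x + y)) - (\<Sum>x\<in>F n. f x) = sum f (?S n - F n) - sum f (F n - ?S n)"
      by linarith
    have abs_sum: "\<bar>sum f A\<bar> \<le> B * card A" for A
    proof -
      have "\<bar>sum f A\<bar> \<le> (\<Sum>x\<in>A. \<bar>f x\<bar>)" by (rule sum_abs)
      also have "\<dots> \<le> card A * B" by (rule sum_bounded_above) (rule B)
      finally show ?thesis by (simp add: mult.commute)
    qed
    have "card (sym_diff (F n) (?S n)) = card (F n - ?S n) + card (?S n - F n)"
      using fin by (subst card_Un_disjoint) auto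
    then have "B * card (sym_diff (F n) (?S n)) = B * card (F n - ?S n) + B * card (?S n - F n)"
      by (simp only: of_nat_add distrib_left)
    then show ?thesis
      unfolding diff using abs_sum[of "?S n - F n"] abs_sum[of "F n - ?S n"] by linarith
  qed
  show ?thesis
  proof (rule Lim_null_comparison[OF always_eventually lim], rule allI)
    show "norm ((\<Sum>x\<in>F n. f (x + y)) / card (F n) - (\<Sum>x\<in>F n. f x) / card (F n))
        \<le> B * (real (card (sym_diff (F n) (?S n))) / real (card (F n)))" for n
      using divide_right_mono[OF bound, of "card (F n)" n]
      by (simp add: abs_divide flip: diff_divide_distrib)
  qed
qed

definition coset_of :: "nat \<Rightarrow> int ^ 'd::finite \<Rightarrow> (int ^ 'd) set" where
  "coset_of p a = range (\<lambda>z. a + int p *s z)"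

lemma cosets_eq_range: "cosets p = range (coset_of p)"
  by (simp add: cosets_def coset_of_def)

lemma mem_coset_of: "x \<in> coset_of p a \<longleftrightarrow> (\<forall>i. int p dvd x $ i - a $ i)"
proof
  assume "\<forall>i. int p dvd x $ i - a $ i"
  then obtain z where "\<And>i. x $ i - a $ i = int p * z i"
    unfolding dvd_def by metis
  then have "x = a + int p *s (\<chi> i. z i)"
    by (simp add: vec_eq_iff diff_eq_eq add.commute)
  then show "x \<in> coset_of p a" by (auto simp: coset_of_def)
qed (auto simp: coset_of_def)

lemma coset_of_eq_iff:
  fixes a b :: "int ^ 'd::finite"
  shows "coset_of p a = coset_of p b \<longleftrightarrow> (\<forall>i. int p dvd a $ i - b $ i)"
proof
  assume "coset_of p a = coset_of p b"
  moreover have "a \<in> coset_of p a" by (simp add: mem_coset_of)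
  ultimately show "\<forall>i. int p dvd a $ i - b $ i" by (simp add: mem_coset_of)
next
  assume *: "\<forall>i. int p dvd a $ i - b $ i"
  have "int p dvd x $ i - a $ i \<longleftrightarrow> int p dvd x $ i - b $ i" for x :: "int^'d" and i
    using dvd_add_right_iff[of "int p" "a $ i - b $ i" "x $ i - a $ i"] * by (simp add: algebra_simps)
  then show "coset_of p a = coset_of p b" by (simp add: set_eq_iff mem_coset_of)
qed

lemma finite_cosets:
  assumes "p > 0"
  shows "finite (cosets p :: (int ^ 'd::finite) set set)"
proof -
  let ?box = "(UNIV :: 'd set) \<rightarrow>\<^sub>E {0..<int p}"
  have "coset_of p a \<in> (\<lambda>f. coset_of p (vec_lambda f)) ` ?box" for a :: "int ^ 'd"
  proof
    show "coset_of p a = coset_of p (\<chi> i. a $ i mod int p)"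
      by (simp add: coset_of_eq_iff flip: mod_eq_dvd_iff)
  qed (use assms in auto)
  then have "cosets p \<subseteq> (\<lambda>f. coset_of p (vec_lambda f)) ` ?box"
    by (auto simp: cosets_eq_range)
  then show ?thesis
    by (rule finite_subset) (intro finite_imageI finite_PiE, auto)
qed

lemma cosets_nonempty: "cosets p \<noteq> {}"
  by (simp add: cosets_def)

text \<open>
  Translating by \<open>m\<close> times representatives of all cosets still visits every coset of \<open>p\<int>\<^sup>d\<close> exactly
  once, since \<open>m\<close> is invertible modulo \<open>p\<close>.
\<close>

lemma sum_over_cosets_shift:
  fixes x :: "int ^ 'd::finite" and G :: "(int ^ 'd) set \<Rightarrow> real"
  assumes "p > 0" "coprime p m" and rep: "\<And>c. c \<in> cosets p \<Longrightarrow> coset_of p (rep c) = c"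
  shows "(\<Sum>c\<in>cosets p. G (coset_of p (- (x + int m *s rep c)))) = (\<Sum>c\<in>cosets p. G c)"
proof (rule sum.reindex_bij_betw)
  let ?h = "\<lambda>c. coset_of p (- (x + int m *s rep c))"
  have inj: "inj_on ?h (cosets p)"
  proof (rule inj_onI)
    fix b c :: "(int ^ 'd) set"
    assume bc: "b \<in> cosets p" "c \<in> cosets p" and "?h b = ?h c"
    then have "int p dvd int m * (rep c $ i - rep b $ i)" for i
      by (simp add: coset_of_eq_iff algebra_simps)
    then have "int p dvd rep c $ i - rep b $ i" for i
      using \<open>coprime p m\<close> by (metis coprime_dvd_mult_right_iff coprime_int_iff)
    then show "b = c" using rep bc coset_of_eq_iff by metis
  qed
  have "?h ` cosets p \<subseteq> cosets p"
    by (auto simp: cosets_eq_range)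
  then have "?h ` cosets p = cosets p"
    by (rule endo_inj_surj[OF finite_cosets[OF \<open>p > 0\<close>] _ inj])
  with inj show "bij_betw ?h (cosets p) (cosets p)"
    by (rule bij_betw_imageI)
qed

text \<open>
  The class of \<open>-x\<close> modulo \<open>p\<close> becomes independent of any \<open>m\<close>-periodic quantity \<open>h\<close>.  Averages
  over \<open>F n\<close> hardly change under translation by a multiple of \<open>m\<close>; averaging over translations by
  \<open>m\<close> times coset representatives leaves \<open>h\<close> alone and replaces \<open>G\<close> by its mean over all cosets.
  This takes the place of the Chinese remainder theorem.
\<close>

lemma coset_average_factors:
  fixes F :: "nat \<Rightarrow> (int ^ 'd::finite) set" and G :: "(int ^ 'd) set \<Rightarrow> real"
  assumes F: "folner F" and p: "p > 0" "coprime p m"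
    and G: "\<And>c. \<bar>G c\<bar> \<le> 1" and h: "\<And>x. \<bar>h x\<bar> \<le> 1"
    and periodic: "\<And>x z. h (x + int m *s z) = h x"
    and lim: "(\<lambda>n. (\<Sum>x\<in>F n. h x) / card (F n)) \<longlonglongrightarrow> l"
  shows "(\<lambda>n. (\<Sum>x\<in>F n. G (coset_of p (- x)) * h x) / card (F n)) \<longlonglongrightarrow>
    (\<Sum>c\<in>cosets p. G c) / card (cosets p :: (int ^ 'd) set set) * l"
proof -
  define C where "C = (cosets p :: (int ^ 'd) set set)"
  have C: "finite C" "card C > 0"
    using finite_cosets[OF p(1)] cosets_nonempty by (auto simp: C_def card_gt_0_iff)
  have "\<forall>c\<in>cosets p. \<exists>a :: int ^ 'd. coset_of p a = c"
    by (auto simp: cosets_eq_range)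
  from bchoice[OF this] obtain rep where rep: "\<And>c. c \<in> cosets p \<Longrightarrow> coset_of p (rep c :: int ^ 'd) = c"
    by blast
  define f where "f x = G (coset_of p (- x)) * h x" for x
  have "\<bar>f x\<bar> \<le> 1" for x
    unfolding f_def abs_mult using mult_mono[OF G h] by simp
  then have "(\<lambda>n. \<Sum>c\<in>C. (\<Sum>x\<in>F n. f (x + int m *s rep c)) / card (F n) - (\<Sum>x\<in>F n. f x) / card (F n))
      \<longlonglongrightarrow> (\<Sum>c\<in>C. 0)"
    by (intro tendsto_sum folner_shift_invariant[OF F])
  moreover have "(\<Sum>c\<in>C. (\<Sum>x\<in>F n. f (x + int m *s rep c)) / card (F n) - (\<Sum>x\<in>F n. f x) / card (F n))
      = sum G C * ((\<Sum>x\<in>F n. h x) / card (F n)) - card C * ((\<Sum>x\<in>F n. f x) / card (F n))" for n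
  proof -
    have "(\<Sum>c\<in>C. \<Sum>x\<in>F n. f (x + int m *s rep c))
        = (\<Sum>x\<in>F n. (\<Sum>c\<in>C. G (coset_of p (- (x + int m *s rep c)))) * h x)"
      by (subst sum.swap) (simp only: f_def periodic sum_distrib_right)
    also have "\<dots> = sum G C * (\<Sum>x\<in>F n. h x)"
      unfolding C_def by (subst sum_over_cosets_shift[OF p rep]) (auto simp: sum_distrib_left)
    finally show ?thesis
      by (simp add: sum_subtractf flip: sum_divide_distrib)
  qed
  ultimately have diff: "(\<lambda>n. sum G C * ((\<Sum>x\<in>F n. h x) / card (F n)) - card C * ((\<Sum>x\<in>F n. f x) / card (F n)))
      \<longlonglongrightarrow> 0"
    by simp
  \<comment> \<open>The average of \<open>f\<close> is written as a combination of the two sequences whose limits are known.\<close>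
  have "(\<lambda>n. (sum G C * ((\<Sum>x\<in>F n. h x) / card (F n)) -
      (sum G C * ((\<Sum>x\<in>F n. h x) / card (F n)) - card C * ((\<Sum>x\<in>F n. f x) / card (F n)))) / card C)
      \<longlonglongrightarrow> (sum G C * l - 0) / card C"
    using C by (intro tendsto_intros lim diff) auto
  then show ?thesis
    using C(2) by (simp add: f_def C_def cosets_nonempty)
qed

text \<open>
  Splitting off one prime \<open>p\<close> at a time, the product over the other primes is periodic modulo their
  product, which is coprime to \<open>p\<close>.
\<close>

lemma coset_equidistribution:
  fixes F :: "nat \<Rightarrow> (int ^ 'd::finite) set" and G :: "nat \<Rightarrow> (int ^ 'd) set \<Rightarrow> real"
  assumes F: "folner F" and G: "\<And>p c. \<bar>G p c\<bar> \<le> 1"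
    and P: "finite P" "\<And>p. p \<in> P \<Longrightarrow> prime p"
  shows "(\<lambda>n. (\<Sum>x\<in>F n. \<Prod>p\<in>P. G p (coset_of p (- x))) / card (F n)) \<longlonglongrightarrow>
    (\<Prod>p\<in>P. (\<Sum>c\<in>cosets p. G p c) / card (cosets p :: (int ^ 'd) set set))"
  using P
proof (induction rule: finite_induct)
  case empty
  have "card (F n) > 0" for n using F by (auto simp: folner_def card_gt_0_iff)
  then show ?case by (simp add: less_imp_neq[symmetric])
next
  case (insert p P)
  define h where "h x = (\<Prod>q\<in>P. G q (coset_of q (- x)))" for x
  have "(\<lambda>n. (\<Sum>x\<in>F n. G p (coset_of p (- x)) * h x) / card (F n)) \<longlonglongrightarrow>
    (\<Sum>c\<in>cosets p. G p c) / card (cosets p :: (int ^ 'd) set set)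
      * (\<Prod>p\<in>P. (\<Sum>c\<in>cosets p. G p c) / card (cosets p :: (int ^ 'd) set set))"
  proof (rule coset_average_factors[OF F])
    show "p > 0" using insert.prems prime_gt_0_nat by auto
    show "coprime p (\<Prod>P)"
    proof (rule prod_coprime_right)
      show "coprime p q" if "q \<in> P" for q
        using that insert.hyps(2) insert.prems[of p] insert.prems[of q] by (intro primes_coprime) auto
    qed
    show "\<bar>h x\<bar> \<le> 1" for x
      unfolding h_def abs_prod by (rule prod_le_1) (simp add: G)
    show "h (x + int (\<Prod>P) *s z) = h x" for x z
    proof -
      have eq: "coset_of q (- (x + int (\<Prod>P) *s z)) = coset_of q (- x)" if "q \<in> P" for q
      proof -
        have "int q dvd int (\<Prod>P)"
          using dvd_prodI[OF insert.hyps(1) that, of "\<lambda>q. q"] by (simp only: of_nat_dvd_iff)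
        then have "int q dvd - (int (\<Prod>P) * z $ i)" for i
          by (simp only: dvd_minus_iff dvd_mult2)
        moreover have "(- (x + int (\<Prod>P) *s z)) $ i - (- x) $ i = - (int (\<Prod>P) * z $ i)" for i
          by (simp del: of_nat_prod)
        ultimately show ?thesis by (simp only: coset_of_eq_iff) simp
      qed
      show ?thesis
        unfolding h_def by (rule prod.cong[OF refl]) (simp only: eq)
    qed
    show "(\<lambda>n. (\<Sum>x\<in>F n. h x) / card (F n)) \<longlonglongrightarrow>
        (\<Prod>p\<in>P. (\<Sum>c\<in>cosets p. G p c) / card (cosets p :: (int ^ 'd) set set))"
      unfolding h_def by (rule insert.IH) (rule insert.prems, simp)
  qed (rule G)
  then show ?case by (simp only: prod.insert[OF insert.hyps] h_def)
qed

section \<open>The joint law of coprimality and residues\<close>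

lemma borel_measurable_config:
  fixes h :: "'a \<Rightarrow> 'i::countable \<Rightarrow> bool"
  assumes "\<And>i. Measurable.pred M (\<lambda>x. h x i)"
  shows "h \<in> borel_measurable M"
proof (rule measurable_coordinatewise_then_product)
  have "A \<in> sets borel" for A :: "bool set"
    by (rule borel_open[OF discrete_topology_class.open_discrete])
  then have "sets (borel :: bool measure) = sets (count_space UNIV)"
    by (simp add: set_eq_iff)
  then show "(\<lambda>x. h x i) \<in> borel_measurable M" for i
    using assms measurable_cong_sets by blast
qed

lemma pred_config_coordinate [measurable]:
  "Measurable.pred borel (\<lambda>w :: 'i \<Rightarrow> bool. w i)"
proof -
  have "(\<lambda>w :: 'i \<Rightarrow> bool. w i) -` {True} \<in> sets borel"
    by (intro borel_open open_vimage[OF discrete_topology_class.open_discrete continuous_on_product_coordinates])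
  then show ?thesis by (simp add: pred_def vimage_def)
qed

text \<open>
  Records, for every prime \<open>p\<close> separately, which points are not removed by \<open>W p\<close>.  Keeping the primes
  apart makes every coordinate depend on a single prime, so a cylinder event involves only finitely
  many primes; the intersection over all primes is taken after passing to the limit.
\<close>

definition sieve_config :: "(nat \<Rightarrow> (int ^ 'd::finite) set) \<Rightarrow> nat \<times> (int ^ 'd) \<Rightarrow> bool" where
  "sieve_config W i \<longleftrightarrow> (prime (fst i) \<longrightarrow> snd i \<notin> W (fst i))"

definition limit_sieve_law :: "(nat \<times> (int ^ 'd::finite) \<Rightarrow> bool) measure" where
  "limit_sieve_law =
     distr (\<Pi>\<^sub>M p\<in>{p. prime p}. uniform_count_measure (cosets p)) borel sieve_config"

definition survivors :: "(nat \<times> (int ^ 'd::finite) \<Rightarrow> bool) \<Rightarrow> 'd config" where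
  "survivors v x \<longleftrightarrow> (\<forall>p. v (p, x))"

lemma prob_space_uniform_cosets:
  "prime p \<Longrightarrow> prob_space (uniform_count_measure (cosets p))"
  by (intro prob_space_uniform_count_measure finite_cosets cosets_nonempty prime_gt_0_nat)

lemma measurable_sieve_config [measurable]:
  "sieve_config \<in> borel_measurable (\<Pi>\<^sub>M p\<in>{p. prime p}. uniform_count_measure (cosets p))"
proof (rule borel_measurable_config)
  fix i :: "nat \<times> (int ^ 'd)"
  show "Measurable.pred (\<Pi>\<^sub>M p\<in>{p. prime p}. uniform_count_measure (cosets p))
      (\<lambda>W. sieve_config W i)"
  proof (cases "prime (fst i)")
    case True
    then have "(\<lambda>W. W (fst i)) \<in> measurable (\<Pi>\<^sub>M p\<in>{p. prime p}. uniform_count_measure (cosets p))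
        (uniform_count_measure (cosets (fst i) :: (int ^ 'd) set set))"
      by (intro measurable_component_singleton) simp
    moreover have "(\<lambda>c. snd i \<notin> c) \<in> measurable (uniform_count_measure (cosets (fst i))) (count_space UNIV)"
      by (simp add: measurable_def sets_uniform_count_measure space_uniform_count_measure)
    ultimately have "(\<lambda>W. snd i \<notin> W (fst i)) \<in> measurable
        (\<Pi>\<^sub>M p\<in>{p. prime p}. uniform_count_measure (cosets p)) (count_space UNIV)"
      by (rule measurable_compose)
    then show ?thesis
      using True by (simp add: sieve_config_def)
  qed (simp add: sieve_config_def)
qed

lemma measurable_survivors [measurable]: "survivors \<in> borel_measurable borel"
  by (rule borel_measurable_config) (simp add: survivors_def)

lemma mu_inf_cop_eq: "(mu_inf_cop :: 'd::finite config measure) = distr limit_sieve_law borel survivors"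
proof -
  have "survivors \<circ> sieve_config = (\<lambda>(W :: nat \<Rightarrow> (int ^ 'd) set) x. x \<notin> (\<Union>p\<in>{p. prime p}. W p))"
    by (auto simp: fun_eq_iff survivors_def sieve_config_def)
  then show ?thesis
    unfolding mu_inf_cop_def limit_sieve_law_def
    by (subst distr_distr) (simp_all only: measurable_survivors measurable_sieve_config)
qed

text \<open>
  The coordinates at non-primes are constantly true, so they contribute only the deterministic
  condition \<open>b\<close>.
\<close>

lemma sieve_config_cylinder:
  assumes "finite J"
  obtains P E b where "finite P" "\<And>p. p \<in> P \<Longrightarrow> prime p"
    "\<And>W. (\<forall>i\<in>J. sieve_config W i \<in> A i) \<longleftrightarrow> b \<and> (\<forall>p\<in>P. W p \<in> E p)"
proof
  show "finite {p \<in> fst ` J. prime p}" using assms by simp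
  show "(\<forall>i\<in>J. sieve_config W i \<in> A i) \<longleftrightarrow>
      (\<forall>i\<in>J. \<not> prime (fst i) \<longrightarrow> True \<in> A i) \<and>
      (\<forall>p\<in>{p \<in> fst ` J. prime p}. W p \<in> {c. \<forall>i\<in>J. fst i = p \<longrightarrow> (snd i \<notin> c) \<in> A i})" for W
  proof -
    have "sieve_config W i \<in> A i \<longleftrightarrow> (\<not> prime (fst i) \<longrightarrow> True \<in> A i) \<and>
        (prime (fst i) \<longrightarrow> (snd i \<notin> W (fst i)) \<in> A i)" for i
      by (cases "prime (fst i)") (simp_all add: sieve_config_def)
    then show ?thesis by auto
  qed
qed simp

lemma measure_distr_uniform_count:
  assumes "finite F" "F \<noteq> {}" and S: "{w. Q w} \<in> sets N" and f: "f \<in> F \<rightarrow> space N"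
  shows "measure (distr (uniform_count_measure F) N f) {w. Q w} = (\<Sum>y\<in>F. of_bool (Q (f y))) / card F"
proof -
  have "f \<in> measurable (uniform_count_measure F) N"
    using f by (simp add: measurable_def sets_uniform_count_measure space_uniform_count_measure)
  moreover have "f -` {w. Q w} \<inter> space (uniform_count_measure F) = {y \<in> F. Q (f y)}"
    by (auto simp: space_uniform_count_measure)
  ultimately have "measure (distr (uniform_count_measure F) N f) {w. Q w} =
      measure (uniform_count_measure F) {y \<in> F. Q (f y)}"
    using S by (simp only: measure_distr)
  also have "\<dots> = card {y \<in> F. Q (f y)} / card F"
    by (rule measure_uniform_count_measure) (use assms in auto)
  also have "card {y \<in> F. Q (f y)} = (\<Sum>y\<in>F. of_bool (Q (f y)))"
    using assms(1) by (simp add: Int_def)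
  finally show ?thesis by simp
qed

lemma cylinder_borel:
  assumes "finite J"
  shows "{w :: 'i \<Rightarrow> bool. \<forall>i\<in>J. w i \<in> A i} \<in> sets borel"
proof -
  have "{w :: 'i \<Rightarrow> bool. \<forall>i\<in>J. w i \<in> A i} = (\<Inter>i\<in>J. (\<lambda>w. w i) -` A i)"
    by auto
  also have "open \<dots>"
    using assms by (intro open_INT ballI
        open_vimage[OF discrete_topology_class.open_discrete continuous_on_product_coordinates])
  finally show ?thesis by (rule borel_open)
qed

text \<open>
  Under the limit law the probability of a cylinder is a product over finitely many primes by
  independence of the cosets, and equidistribution yields the same product.
\<close>

lemma sieve_law_convergence:
  fixes F :: "nat \<Rightarrow> (int ^ 'd::finite) set" and A :: "nat \<times> (int ^ 'd) \<Rightarrow> bool set"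
  assumes F: "folner F" and J: "finite J"
  shows "(\<lambda>n. measure (distr (uniform_count_measure (F n)) borel
            (\<lambda>y. sieve_config (\<lambda>p. coset_of p (- y)))) {v. \<forall>i\<in>J. v i \<in> A i})
    \<longlonglongrightarrow> measure limit_sieve_law {v. \<forall>i\<in>J. v i \<in> A i}"
proof -
  obtain P E b where P: "finite P" "\<And>p. p \<in> P \<Longrightarrow> prime p"
    and cyl: "\<And>W. (\<forall>i\<in>J. sieve_config W i \<in> A i) \<longleftrightarrow> b \<and> (\<forall>p\<in>P. W p \<in> E p)"
    by (rule sieve_config_cylinder[OF J, of A]) blast
  let ?C = "\<lambda>p. cosets p :: (int ^ 'd) set set"
  let ?\<Pi> = "\<Pi>\<^sub>M p\<in>{p. prime p}. uniform_count_measure (?C p)"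
  define G where "G p c = (of_bool (c \<in> E p) :: real)" for p c
  have fin: "finite (F n)" "F n \<noteq> {}" for n using F by (auto simp: folner_def)
  have "measure (distr (uniform_count_measure (F n)) borel
            (\<lambda>y. sieve_config (\<lambda>p. coset_of p (- y)))) {v. \<forall>i\<in>J. v i \<in> A i}
      = of_bool b * ((\<Sum>y\<in>F n. \<Prod>p\<in>P. G p (coset_of p (- y))) / card (F n))" for n
    using P(1) by (subst measure_distr_uniform_count[OF fin cylinder_borel[OF J]])
      (simp_all add: cyl G_def of_bool_conj of_bool_Ball_eq_prod sum_distrib_left del: of_bool_eq_iff)
  moreover have "measure limit_sieve_law {v. \<forall>i\<in>J. v i \<in> A i}
      = of_bool b * (\<Prod>p\<in>P. (\<Sum>c\<in>?C p. G p c) / card (?C p))"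
  proof -
    have "emeasure ?\<Pi> (prod_emb {p. prime p} (\<lambda>p. uniform_count_measure (?C p)) P
        (Pi\<^sub>E P (\<lambda>p. ?C p \<inter> E p))) = (\<Prod>p\<in>P. emeasure (uniform_count_measure (?C p)) (?C p \<inter> E p))"
      using P by (intro emeasure_PiM_emb) (auto simp: prob_space_uniform_cosets sets_uniform_count_measure)
    also have "\<dots> = (\<Prod>p\<in>P. ennreal (measure (uniform_count_measure (?C p)) (?C p \<inter> E p)))"
      using P(2) by (intro prod.cong refl finite_measure.emeasure_eq_measure
          prob_space.finite_measure prob_space_uniform_cosets)
    also have "\<dots> = ennreal (\<Prod>p\<in>P. measure (uniform_count_measure (?C p)) (?C p \<inter> E p))"
      by (rule prod_ennreal) simp
    finally have "measure ?\<Pi> (prod_emb {p. prime p} (\<lambda>p. uniform_count_measure (?C p)) P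
        (Pi\<^sub>E P (\<lambda>p. ?C p \<inter> E p))) = (\<Prod>p\<in>P. measure (uniform_count_measure (?C p)) (?C p \<inter> E p))"
      by (intro measure_eq_emeasure_eq_ennreal prod_nonneg) simp_all
    also have "\<dots> = (\<Prod>p\<in>P. (\<Sum>c\<in>?C p. G p c) / card (?C p))"
      using P by (intro prod.cong refl)
        (simp add: measure_uniform_count_measure finite_cosets prime_gt_0_nat G_def Int_def)
    also have "prod_emb {p. prime p} (\<lambda>p. uniform_count_measure (?C p)) P (Pi\<^sub>E P (\<lambda>p. ?C p \<inter> E p))
        = {W \<in> space ?\<Pi>. \<forall>p\<in>P. W p \<in> E p}"
      using P by (auto simp: prod_emb_def space_PiM PiE_iff space_uniform_count_measure extensional_def)
    finally have *: "measure ?\<Pi> {W \<in> space ?\<Pi>. \<forall>p\<in>P. W p \<in> E p} =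
        (\<Prod>p\<in>P. (\<Sum>c\<in>?C p. G p c) / card (?C p))" .
    have "sieve_config -` {v. \<forall>i\<in>J. v i \<in> A i} \<inter> space ?\<Pi>
        = (if b then {W \<in> space ?\<Pi>. \<forall>p\<in>P. W p \<in> E p} else {})"
      using cyl by auto
    then show ?thesis
      unfolding limit_sieve_law_def
      by (subst measure_distr[OF measurable_sieve_config cylinder_borel[OF J]]) (simp add: *)
  qed
  moreover have "(\<lambda>n. of_bool b * ((\<Sum>y\<in>F n. \<Prod>p\<in>P. G p (coset_of p (- y))) / card (F n)))
      \<longlonglongrightarrow> of_bool b * (\<Prod>p\<in>P. (\<Sum>c\<in>?C p. G p c) / card (?C p))"
    by (intro tendsto_mult_left coset_equidistribution[OF F _ P]) (auto simp: G_def)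
  ultimately show ?thesis by simp
qed

text \<open>
  The left coordinates show the coprime points seen from \<open>y\<close>, the right coordinates the classes of \<open>y\<close>
  modulo all primes.  The coset for \<open>p\<close> is the one of \<open>-y\<close> because \<open>p\<close> divides \<open>x + y\<close> exactly
  when \<open>x\<close> lies in it.
\<close>

definition joint_config :: "int ^ 'd::finite \<Rightarrow> (int ^ 'd) + nat \<times> (int ^ 'd) \<Rightarrow> bool" where
  "joint_config y = case_sum (\<lambda>x. cop (x + y)) (sieve_config (\<lambda>p. coset_of p (- y)))"

lemma cop_avoids_coset:
  assumes "cop (x + y)" "prime p"
  shows "x \<notin> coset_of p (- y)"
proof
  assume "x \<in> coset_of p (- y)"
  then have "int p dvd Gcd (range (\<lambda>i. (x + y) $ i))"
    by (intro Gcd_greatest) (auto simp: mem_coset_of)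
  then show False
    using assms by (simp add: cop_def)
qed

lemma joint_config_mono: "joint_config y (Inl x) \<Longrightarrow> joint_config y (Inr (p, x))"
  using cop_avoids_coset by (auto simp: joint_config_def sieve_config_def)

theorem proposition2p4:
  fixes F :: "nat \<Rightarrow> (int ^ 'd::finite) set" and \<mu> :: "(int ^ 'd \<Rightarrow> bool) measure"
  assumes "folner F"
    and "prob_space \<mu>" and "sets \<mu> = sets borel"
    and "converges_weakly (\<lambda>n. mu_cop (F n)) \<mu>"
  shows "stoch_dominated \<mu> mu_inf_cop"
proof -
  let ?left = "\<lambda>u :: (int ^ 'd) + nat \<times> (int ^ 'd) \<Rightarrow> bool. \<lambda>x. u (Inl x)"
  let ?right = "\<lambda>u :: (int ^ 'd) + nat \<times> (int ^ 'd) \<Rightarrow> bool. \<lambda>i. u (Inr i)"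
  have fin: "finite (F n)" "F n \<noteq> {}" for n using assms(1) by (auto simp: folner_def)
  have meas: "f \<in> measurable (uniform_count_measure (F n)) borel"
    for f :: "int ^ 'd \<Rightarrow> 'i::countable \<Rightarrow> bool" and n
    by (simp add: measurable_def sets_uniform_count_measure space_uniform_count_measure)
  define M where "M n = distr (uniform_count_measure (F n)) borel joint_config" for n
  have prob_M: "prob_space (M n)" for n
    unfolding M_def by (intro prob_space.prob_space_distr prob_space_uniform_count_measure fin meas)
  have sets_M: "sets (M n) = sets borel" for n by (simp add: M_def)
  obtain r L where r: "strict_mono (r :: nat \<Rightarrow> nat)" and L: "prob_space L" and sets_L: "sets L = sets borel"
    and conv: "converges_weakly (M \<circ> r) L"
    by (rule weakly_convergent_subsequence[OF prob_M sets_M])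
  interpret L: prob_space L by fact
  note [measurable_cong] = sets_L
  have space_L: "space L = UNIV" using sets_eq_imp_space_eq[OF sets_L] by simp
  have cont: "continuous_on UNIV ?left" "continuous_on UNIV ?right"
    by (intro continuous_on_coordinatewise_then_product continuous_on_product_coordinates)+
  have [measurable]: "?left \<in> borel_measurable borel" "?right \<in> borel_measurable borel"
    by (intro borel_measurable_continuous_onI cont)+
  have left_M: "distr (M n) borel ?left = mu_cop (F n)" for n
    unfolding M_def mu_cop_def by (subst distr_distr) (auto simp: meas comp_def joint_config_def)
  have right_M: "distr (M n) borel ?right =
      distr (uniform_count_measure (F n)) borel (\<lambda>y. sieve_config (\<lambda>p. coset_of p (- y)))" for n
    unfolding M_def by (subst distr_distr) (auto simp: meas comp_def joint_config_def)
  have conv_left: "converges_weakly (\<lambda>n. mu_cop (F (r n))) (distr L borel ?left)"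
    using converges_weakly_distr[OF conv cont(1)] by (simp add: sets_M sets_L left_M)
  have conv_right: "converges_weakly (\<lambda>n. distr (M (r n)) borel ?right) (distr L borel ?right)"
    using converges_weakly_distr[OF conv cont(2)] by (simp add: sets_M sets_L)
  \<comment> \<open>Each marginal of \<open>L\<close> is pinned down by its cylinder probabilities, as limits along \<open>r\<close>.\<close>
  have left: "distr L borel ?left = \<mu>"
  proof (rule config_measure_eqI)
    show "finite_measure (distr L borel ?left)"
      by (intro prob_space.finite_measure L.prob_space_distr) measurable
    show "finite_measure \<mu>" using assms(2) by (rule prob_space.finite_measure)
    fix J :: "(int ^ 'd) set" and A :: "int ^ 'd \<Rightarrow> bool set" assume "finite J"
    then show "measure (distr L borel ?left) {w. \<forall>i\<in>J. w i \<in> A i} = measure \<mu> {w. \<forall>i\<in>J. w i \<in> A i}"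
      using converges_weakly_cylinder[OF conv_left, of J A]
        converges_weakly_cylinder[OF converges_weakly_subsequence[OF assms(4) r], of J A] assms(3)
      by (intro LIMSEQ_unique) (auto simp: mu_cop_def comp_def)
  qed (simp_all add: assms(3))
  have right: "distr L borel ?right = limit_sieve_law"
  proof (rule config_measure_eqI)
    show "finite_measure (distr L borel ?right)"
      by (intro prob_space.finite_measure L.prob_space_distr) measurable
    show "finite_measure (limit_sieve_law :: (nat \<times> (int ^ 'd) \<Rightarrow> bool) measure)"
      unfolding limit_sieve_law_def
      by (intro prob_space.finite_measure prob_space.prob_space_distr measurable_sieve_config
          prob_space_PiM prob_space_uniform_cosets) simp
    fix J :: "(nat \<times> (int ^ 'd)) set" and A :: "nat \<times> (int ^ 'd) \<Rightarrow> bool set" assume J: "finite J"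
    from converges_weakly_cylinder[OF conv_right J, of A]
      LIMSEQ_subseq_LIMSEQ[OF sieve_law_convergence[OF assms(1) J, of A] r]
    show "measure (distr L borel ?right) {v. \<forall>i\<in>J. v i \<in> A i} =
        measure limit_sieve_law {v. \<forall>i\<in>J. v i \<in> A i}"
      by (intro LIMSEQ_unique) (auto simp: right_M comp_def)
  qed (simp_all add: limit_sieve_law_def)
  have "AE u in L. u (Inl x) \<longrightarrow> u (Inr (p, x))" for p and x :: "int ^ 'd"
  proof -
    let ?J = "{Inl x, Inr (p, x)}"
    let ?A = "case_sum (\<lambda>_. {True}) (\<lambda>_. {False})"
    let ?S = "{u. \<forall>i\<in>?J. u i \<in> ?A i}"
    \<comment> \<open>The violating event is a cylinder that is null before the limit, hence null in the limit.\<close>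
    have none: "(\<forall>i\<in>?J. joint_config y i \<in> ?A i) \<longleftrightarrow> False" for y
      using joint_config_mono[of y x p] by auto
    have "measure (M n) ?S = (\<Sum>y\<in>F n. of_bool (\<forall>i\<in>?J. joint_config y i \<in> ?A i)) / card (F n)" for n
      unfolding M_def by (rule measure_distr_uniform_count[OF fin cylinder_borel]) simp_all
    then have "measure (M n) ?S = 0" for n
      unfolding none by simp
    then have "measure L ?S = 0"
      using converges_weakly_cylinder[OF conv, of ?J ?A] by (simp add: sets_M sets_L LIMSEQ_const_iff)
    moreover have "?S = {u \<in> space L. \<not> (u (Inl x) \<longrightarrow> u (Inr (p, x)))}"
      by (auto simp: space_L)
    ultimately show ?thesis
      by (subst AE_iff_measurable[OF _ refl]) (auto simp: L.emeasure_eq_measure)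
  qed
  then have dom: "AE u in L. \<forall>x p. u (Inl x) \<longrightarrow> u (Inr (p, x))"
    unfolding AE_all_countable by blast
  define K where "K = distr L (borel \<Otimes>\<^sub>M borel) (\<lambda>u. (?left u, survivors (?right u)))"
  have K_meas [measurable]: "(\<lambda>u. (?left u, survivors (?right u))) \<in> measurable L (borel \<Otimes>\<^sub>M borel)"
    by measurable
  have "coupling K \<mu> mu_inf_cop"
    unfolding coupling_def
  proof (intro conjI)
    show "prob_space K" unfolding K_def by (rule L.prob_space_distr[OF K_meas])
    show "distr K borel fst = \<mu>"
      unfolding K_def left[symmetric] by (subst distr_distr) (auto simp: comp_def)
    show "distr K borel snd = mu_inf_cop"
      unfolding K_def mu_inf_cop_eq right[symmetric] by (simp add: distr_distr comp_def)
  qed (simp add: K_def)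
  moreover have "AE w in K. {x. fst w x} \<subseteq> {x. snd w x}"
    unfolding K_def
  proof (subst AE_distr_iff[OF K_meas])
    have "Measurable.pred (borel \<Otimes>\<^sub>M borel) (\<lambda>w :: 'd config \<times> 'd config. \<forall>x. fst w x \<longrightarrow> snd w x)"
      by measurable
    then show "{w \<in> space (borel \<Otimes>\<^sub>M borel). {x. fst w x} \<subseteq> {x. snd w x}}
        \<in> sets (borel \<Otimes>\<^sub>M borel :: ('d config \<times> 'd config) measure)"
      by (simp add: pred_def subset_iff)
    show "AE u in L. {x. fst (?left u, survivors (?right u)) x} \<subseteq> {x. snd (?left u, survivors (?right u)) x}"
      using dom by eventually_elim (auto simp: survivors_def)
  qed
  ultimately show ?thesis
    unfolding stoch_dominated_def by blast
qed

end
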